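(* For all integers $n\ge 0$ and $r\ge 0$, \[ B_{n,r}^{L}=\frac{1}{e}\sum_{k=0}^{\infty}\frac{\langle k+2r\rangle_{n}}{k!}. \]
   Context: For a nonnegative integer $r$ and integers $0\le k\le n$, the $r$-Lah number $L_r(n,k)$ is the number of partitions of a set with $n+r$ elements into $k+r$ non-empty linearly ordered subsets such that $r$ distinguished elements lie in distinct subsets; equivalently $L_r(n,k)=\frac{n!}{k!}\binom{n+2r-1}{k+2r-1}$. The $r$-extended Lah-Bell number is $B^L_{n,r}=\sum_{k=0}^n L_r(n,k)$ (the number of ways to partition a set of $n+r$ elements into non-empty linearly ordered subsets with $r$ distinguished elements in distinct subsets). The rising factorial is $\langle x\rangle_0=1$, $\langle x\rangle_n=x(x+1)\cdots(x+n-1)$ for $n\ge1$. *)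

theory Defs
  imports Complex_Main "HOL-Library.Disjoint_Sets"
begin

text \<open>
  A linearly ordered finite set is represented by the list enumerating its elements in
  increasing order, without repetition. The injectivity condition says that each block of the
  partition carries a single order.
\<close>

definition ordered_partition_on :: "'a set \<Rightarrow> 'a list set \<Rightarrow> bool" where
  "ordered_partition_on A P \<longleftrightarrow>
     partition_on A (set ` P) \<and> inj_on set P \<and> (\<forall>xs\<in>P. distinct xs)"

definition separates :: "'a list set \<Rightarrow> 'a set \<Rightarrow> bool" where
  "separates P D \<longleftrightarrow> (\<forall>xs\<in>P. \<forall>x\<in>D. \<forall>y\<in>D. x \<in> set xs \<longrightarrow> y \<in> set xs \<longrightarrow> x = y)"

text \<open>
  The underlying set with \<open>n + r\<close> elements is \<open>{..<n + r}\<close>; its \<open>r\<close> distinguished elements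
  are those of \<open>{..<r}\<close>.
\<close>

definition r_Lah :: "nat \<Rightarrow> nat \<Rightarrow> nat \<Rightarrow> nat" where
  "r_Lah r n k =
     card {P. ordered_partition_on {..<n + r} P \<and> card P = k + r \<and> separates P {..<r}}"

definition Lah_Bell :: "nat \<Rightarrow> nat \<Rightarrow> nat" where
  "Lah_Bell n r = (\<Sum>k = 0..n. r_Lah r n k)"

end

theory Submission
  imports Defs
begin

text \<open>
  A new element \<open>x\<close> joins an ordered partition \<open>Q\<close> of \<open>A\<close> either as a block of its own or at one of
  the \<open>card A + card Q\<close> positions inside the existing blocks. With \<open>k = card Q - r\<close> and falling
  factorials \<open>y(y - 1)\<dots>(y - k + 1)\<close> this matches the rule for multiplying by
  \<open>y + 2r + n = (y - k) + (n + 2r + k)\<close>, so that the rising factorial \<open>\<langle>y + 2r\<rangle>\<^sub>n\<close> is the sum of the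
  falling factorials of order \<open>card Q - r\<close> over all admissible \<open>Q\<close>. Dividing by \<open>y!\<close> and
  summing over \<open>y\<close>, each \<open>Q\<close> contributes \<open>e\<close>.
\<close>

section \<open>Ordered partitions\<close>

text \<open>The number of blocks is left free. It enters later only through weights
  \<open>f (card P)\<close>, so one recursion on the ground set serves all block numbers at
  once.\<close>

definition ordered_partitions :: "'a set \<Rightarrow> 'a set \<Rightarrow> 'a list set set" where
  "ordered_partitions A D = {P. ordered_partition_on A P \<and> separates P D}"

text \<open>Disjointness of the blocks and injectivity of \<open>set\<close> merge into one
  elementwise condition: lists with a common element coincide. Conversely, two lists with the same
  set share the head of either one, as no list is empty.\<close>

lemma ordered_partition_on_iff:
  "ordered_partition_on A P \<longleftrightarrow>
     (\<Union>xs\<in>P. set xs) = A \<and> (\<forall>xs\<in>P. xs \<noteq> [] \<and> distinct xs) \<and>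
     (\<forall>xs\<in>P. \<forall>ys\<in>P. \<forall>a. a \<in> set xs \<longrightarrow> a \<in> set ys \<longrightarrow> xs = ys)" (is "?L \<longleftrightarrow> ?R")
proof
  assume L: ?L
  have "xs = ys" if "xs \<in> P" "ys \<in> P" "a \<in> set xs" "a \<in> set ys" for xs ys a
  proof -
    have "set xs = set ys"
      using L that unfolding ordered_partition_on_def partition_on_def disjoint_def by blast
    then show ?thesis
      using L that unfolding ordered_partition_on_def by (auto dest: inj_onD)
  qed
  then show ?R
    using L unfolding ordered_partition_on_def partition_on_def by auto
next
  assume R: ?R
  have "inj_on set P"
  proof (rule inj_onI)
    fix xs ys assume xy: "xs \<in> P" "ys \<in> P" "set xs = set ys"
    then have "hd xs \<in> set xs" "hd xs \<in> set ys"
      using R by (metis hd_in_set)+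
    then show "xs = ys" using R xy by blast
  qed
  moreover have "disjoint (set ` P)"
    using R unfolding disjoint_def by fast
  ultimately show ?L
    using R unfolding ordered_partition_on_def partition_on_def by auto
qed

lemma ordered_partitionsD:
  assumes "P \<in> ordered_partitions A D"
  shows "(\<Union>xs\<in>P. set xs) = A"
    and "\<And>xs. xs \<in> P \<Longrightarrow> xs \<noteq> [] \<and> distinct xs"
    and "\<And>xs ys a. xs \<in> P \<Longrightarrow> ys \<in> P \<Longrightarrow> a \<in> set xs \<Longrightarrow> a \<in> set ys \<Longrightarrow> xs = ys"
    and "\<And>xs a b. xs \<in> P \<Longrightarrow> a \<in> D \<Longrightarrow> b \<in> D \<Longrightarrow> a \<in> set xs \<Longrightarrow> b \<in> set xs \<Longrightarrow> a = b"
proof -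
  have op: "ordered_partition_on A P" and sep: "separates P D"
    using assms by (simp_all add: ordered_partitions_def)
  note op' = op[unfolded ordered_partition_on_iff]
  show "(\<Union>xs\<in>P. set xs) = A" by (rule conjunct1[OF op'])
  show "xs \<noteq> [] \<and> distinct xs" if "xs \<in> P" for xs
    using conjunct1[OF conjunct2[OF op']] that by (rule bspec)
  show "xs = ys" if "xs \<in> P" "ys \<in> P" "a \<in> set xs" "a \<in> set ys" for xs ys a
    using conjunct2[OF conjunct2[OF op']] that by blast
  show "a = b" if "xs \<in> P" "a \<in> D" "b \<in> D" "a \<in> set xs" "b \<in> set xs" for xs a b
    using sep that unfolding separates_def by blast
qed

lemma finite_ordered_partitions:
  assumes "finite A"
  shows "finite (ordered_partitions A D)"
proof (rule finite_subset)
  show "ordered_partitions A D \<subseteq> Pow {xs. set xs \<subseteq> A \<and> distinct xs}"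
    unfolding ordered_partitions_def ordered_partition_on_iff by auto
  show "finite (Pow {xs. set xs \<subseteq> A \<and> distinct xs})"
    using finite_subset_distinct[OF assms] by simp
qed

lemma ordered_partition_on_finite:
  assumes "finite A" "ordered_partition_on A P"
  shows "finite P"
proof (rule finite_subset)
  show "P \<subseteq> {xs. set xs \<subseteq> A \<and> distinct xs}"
    using assms(2) unfolding ordered_partition_on_iff by auto
qed (rule finite_subset_distinct[OF assms(1)])

text \<open>Supplies the count of insertion positions: a block of length m offers m + 1 of them,
  hence all blocks together offer \<open>card A + card P\<close>.\<close>

lemma sum_length_ordered_partition:
  assumes "finite A" "ordered_partition_on A P"
  shows "(\<Sum>xs\<in>P. length xs) = card A"
proof -
  have "card (\<Union>xs\<in>P. set xs) = (\<Sum>xs\<in>P. card (set xs))"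
    using assms(2) ordered_partition_on_finite[OF assms]
    by (intro card_UN_disjoint) (auto simp: ordered_partition_on_iff)
  also have "\<dots> = (\<Sum>xs\<in>P. length xs)"
    using assms(2) by (intro sum.cong) (auto simp: ordered_partition_on_iff distinct_card)
  finally show ?thesis
    using assms(2) by (simp add: ordered_partition_on_iff)
qed

text \<open>Base case of the recursion. When all elements are distinguished, a second entry of a
  block would have to equal the first, against distinctness.\<close>

lemma ordered_partitions_self: "ordered_partitions D D = {(\<lambda>a. [a]) ` D}"
proof (intro set_eqI iffI)
  fix P assume "P \<in> ordered_partitions D D"
  then have P: "ordered_partition_on D P" and sep: "separates P D"
    by (auto simp: ordered_partitions_def)
  have single: "\<exists>a\<in>D. xs = [a]" if "xs \<in> P" for xs
  proof -
    have d: "distinct xs" "xs \<noteq> []" "set xs \<subseteq> D"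
      using P that by (auto simp: ordered_partition_on_iff)
    obtain a ys where xs: "xs = a # ys" using d(2) by (cases xs) auto
    have "ys = []"
    proof (cases ys)
      case (Cons b zs)
      then have "a = b"
        using sep that d xs unfolding separates_def by (metis list.set_intros subset_iff)
      with d xs Cons show ?thesis by simp
    qed
    then show ?thesis using xs d by auto
  qed
  moreover have "[a] \<in> P" if "a \<in> D" for a
  proof -
    have "a \<in> (\<Union>xs\<in>P. set xs)"
      using P that by (simp add: ordered_partition_on_iff)
    then obtain xs where xs: "xs \<in> P" "a \<in> set xs" by blast
    with single obtain b where "xs = [b]" by blast
    with xs show ?thesis by simp
  qed
  ultimately show "P \<in> {(\<lambda>a. [a]) ` D}" by blast
next
  fix P assume "P \<in> {(\<lambda>a. [a]) ` D}"
  then show "P \<in> ordered_partitions D D"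
    by (auto simp: ordered_partitions_def ordered_partition_on_iff separates_def)
qed

section \<open>Inserting an element\<close>

text \<open>Every index beyond \<open>length xs\<close> has the same effect as
  \<open>length xs\<close> itself, so positions are counted over \<open>{..length xs}\<close>
  only.\<close>

definition insert_at :: "'a \<Rightarrow> 'a list \<Rightarrow> nat \<Rightarrow> 'a list" where
  "insert_at x xs i = take i xs @ x # drop i xs"

definition extensions :: "'a \<Rightarrow> 'a list set \<Rightarrow> 'a list set set" where
  "extensions x Q = insert (insert [x] Q)
     ((\<lambda>(xs, i). insert (insert_at x xs i) (Q - {xs})) ` (SIGMA xs:Q. {..length xs}))"

lemma set_insert_at [simp]: "set (insert_at x xs i) = insert x (set xs)"
  unfolding insert_at_def by (metis append_take_drop_id list.simps(15) set_append Un_insert_right)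

lemma distinct_insert_at: "distinct xs \<Longrightarrow> x \<notin> set xs \<Longrightarrow> distinct (insert_at x xs i)"
  unfolding insert_at_def
  by (auto simp: set_take_disj_set_drop_if_distinct dest: in_set_takeD in_set_dropD)

lemma insert_at_nonempty [simp]: "insert_at x xs i \<noteq> []"
  by (simp add: insert_at_def)

lemma removeAll_insert_at: "x \<notin> set xs \<Longrightarrow> removeAll x (insert_at x xs i) = xs"
  by (metis append_take_drop_id insert_at_def removeAll.simps(2) removeAll_append removeAll_id)

text \<open>Deleting \<open>x\<close> recovers the list, and the number of entries before
  \<open>x\<close> recovers the position; the bounds on \<open>i\<close> and \<open>j\<close> make
  that number equal to the index.\<close>

lemma insert_at_inject:
  assumes "x \<notin> set xs" "x \<notin> set ys" "i \<le> length xs" "j \<le> length ys"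
    and eq: "insert_at x xs i = insert_at x ys j"
  shows "xs = ys \<and> i = j"
proof -
  have "xs = ys"
    using assms removeAll_insert_at by metis
  moreover have "take i xs = take j ys"
    using eq assms(1,2) unfolding insert_at_def
    by (metis append_Cons_eq_iff in_set_takeD in_set_dropD)
  ultimately show ?thesis
    using assms(3,4) by (metis length_take min.absorb2)
qed

lemma extensions_subset:
  assumes Q: "Q \<in> ordered_partitions A D" and x: "x \<notin> A" and D: "D \<subseteq> A"
  shows "extensions x Q \<subseteq> ordered_partitions (insert x A) D"
proof
  fix P assume "P \<in> extensions x Q"
  note Q1 = ordered_partitionsD(1-3)[OF Q] and sep = ordered_partitionsD(4)[OF Q]
  have xQ: "x \<notin> set xs" if "xs \<in> Q" for xs using that Q1(1) x by blast
  have xD: "x \<notin> D" using x D by blast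
  from \<open>P \<in> extensions x Q\<close> consider "P = insert [x] Q"
    | l i where "l \<in> Q" "P = insert (insert_at x l i) (Q - {l})"
    unfolding extensions_def by auto
  then show "P \<in> ordered_partitions (insert x A) D"
  proof cases
    case 1
    show ?thesis
      unfolding ordered_partitions_def ordered_partition_on_iff separates_def 1 mem_Collect_eq
      using Q1 sep xQ xD by auto
  next
    case 2
    have "(\<Union>xs\<in>P. set xs) = insert x A"
      using 2 Q1(1) by auto
    moreover have "\<forall>xs\<in>P. xs \<noteq> [] \<and> distinct xs"
      using 2 Q1(2) xQ by (auto intro: distinct_insert_at)
    moreover have "\<forall>xs\<in>P. \<forall>ys\<in>P. \<forall>a. a \<in> set xs \<longrightarrow> a \<in> set ys \<longrightarrow> xs = ys"
      unfolding 2(2) using Q1(3)[OF 2(1)] Q1(3) 2(1) xQ by auto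
    moreover have "separates P D"
      unfolding separates_def 2(2) using sep 2(1) xD by auto
    ultimately show ?thesis
      unfolding ordered_partitions_def ordered_partition_on_iff by blast
  qed
qed

lemma ordered_partitions_insert:
  assumes x: "x \<notin> A" and D: "D \<subseteq> A"
  shows "ordered_partitions (insert x A) D = (\<Union>Q\<in>ordered_partitions A D. extensions x Q)"
proof (rule equalityI)
  show "(\<Union>Q\<in>ordered_partitions A D. extensions x Q) \<subseteq> ordered_partitions (insert x A) D"
    using extensions_subset[OF _ x D] by blast
next
  show "ordered_partitions (insert x A) D \<subseteq> (\<Union>Q\<in>ordered_partitions A D. extensions x Q)"
  proof
    fix P assume P: "P \<in> ordered_partitions (insert x A) D"
    note P1 = ordered_partitionsD(1-3)[OF P] and sep = ordered_partitionsD(4)[OF P]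
    obtain l where l: "l \<in> P" "x \<in> set l" using P1(1) by blast
    \<comment> \<open>Undo the insertion by cutting the block of \<open>x\<close> around
      \<open>x\<close>. If nothing else is in it, the whole block is dropped; otherwise
      \<open>as @ bs\<close> replaces it and \<open>x\<close> goes back at position
      \<open>length as\<close>.\<close>
    obtain as bs where ab: "l = as @ x # bs" using l(2) by (meson split_list)
    define R where "R = P - {l}"
    have PR: "P = insert l R" "l \<notin> R" using l by (auto simp: R_def)
    have disj: "set xs \<inter> set l = {}" if "xs \<in> R" for xs
      using that P1(3)[of xs l] l by (auto simp: R_def)
    have xab: "x \<notin> set (as @ bs)" "distinct (as @ bs)" using P1(2)[OF l(1)] ab by auto
    have UR: "(\<Union>xs\<in>R. set xs) \<union> set (as @ bs) = A"
    proof -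
      have "insert x ((\<Union>xs\<in>R. set xs) \<union> set (as @ bs)) = insert x A"
        using P1(1) PR ab by auto
      moreover have "x \<notin> (\<Union>xs\<in>R. set xs) \<union> set (as @ bs)"
        using disj l(2) xab by blast
      ultimately show ?thesis using x by (metis Diff_insert_absorb)
    qed
    have R1: "xs \<noteq> [] \<and> distinct xs" if "xs \<in> R" for xs using P1(2) that PR by blast
    have R2: "xs = ys" if "xs \<in> R" "ys \<in> R" "a \<in> set xs" "a \<in> set ys" for xs ys a
      using P1(3) that PR by blast
    have R3: "a = b" if "xs \<in> R" "a \<in> D" "b \<in> D" "a \<in> set xs" "b \<in> set xs" for xs a b
      using sep that PR by blast
    show "P \<in> (\<Union>Q\<in>ordered_partitions A D. extensions x Q)"
    proof (cases "as @ bs = []")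
      case True
      have "R \<in> ordered_partitions A D"
        unfolding ordered_partitions_def ordered_partition_on_iff separates_def mem_Collect_eq
        using UR True R1 R2 R3 by (simp; blast)
      moreover have "P \<in> extensions x R"
        unfolding extensions_def using PR ab True by simp
      ultimately show ?thesis by blast
    next
      case False
      define Q where "Q = insert (as @ bs) R"
      have dab: "set xs \<inter> set (as @ bs) = {}" if "xs \<in> R" for xs
        using disj[OF that] ab by auto
      have abR: "as @ bs \<notin> R" using dab False by fastforce
      have "(\<Union>xs\<in>Q. set xs) = A" using UR by (auto simp: Q_def)
      moreover have "\<forall>xs\<in>Q. xs \<noteq> [] \<and> distinct xs" using R1 xab False by (auto simp: Q_def)
      moreover have "\<forall>xs\<in>Q. \<forall>ys\<in>Q. \<forall>a. a \<in> set xs \<longrightarrow> a \<in> set ys \<longrightarrow> xs = ys"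
        unfolding Q_def using R2 dab by blast
      moreover have "separates Q D"
        unfolding separates_def Q_def using R3 sep[OF l(1)] ab by auto
      ultimately have "Q \<in> ordered_partitions A D"
        unfolding ordered_partitions_def ordered_partition_on_iff by blast
      moreover have "P = insert (insert_at x (as @ bs) (length as)) (Q - {as @ bs})"
        using PR ab abR by (simp add: insert_at_def Q_def)
      then have "P \<in> extensions x Q"
        unfolding extensions_def by (auto simp: Q_def intro!: image_eqI[where x="(as @ bs, length as)"])
      ultimately show ?thesis by blast
    qed
  qed
qed

text \<open>Deleting \<open>x\<close> everywhere inverts both kinds of extension; a block
  \<open>[x]\<close> turns into the empty list, which is then discarded. Hence distinct partitions
  have no extension in common.\<close>

lemma extensions_remove:
  assumes "P \<in> extensions x Q" and x: "\<And>xs. xs \<in> Q \<Longrightarrow> x \<notin> set xs" and e: "[] \<notin> Q"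
  shows "removeAll x ` P - {[]} = Q"
proof -
  have im: "removeAll x ` R = R" if "R \<subseteq> Q" for R
    using that x by (force simp: image_iff)
  from assms(1) consider "P = insert [x] Q"
    | l i where "l \<in> Q" "P = insert (insert_at x l i) (Q - {l})"
    unfolding extensions_def by auto
  then show ?thesis
  proof cases
    case 1
    then show ?thesis using im[of Q] e by simp
  next
    case 2
    then show ?thesis
      using im[of "Q - {l}"] e removeAll_insert_at[OF x[OF 2(1)]] by auto
  qed
qed

section \<open>Weighted sums over extensions\<close>

lemma sum_extensions:
  fixes f :: "nat \<Rightarrow> real"
  assumes "finite A" and Q: "ordered_partition_on A Q" and x: "x \<notin> A"
  shows "(\<Sum>P\<in>extensions x Q. f (card P)) =
    f (Suc (card Q)) + real (card A + card Q) * f (card Q)"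
proof -
  have fin: "finite Q" by (rule ordered_partition_on_finite[OF assms(1,2)])
  have xQ: "x \<notin> set xs" if "xs \<in> Q" for xs
    using Q x that by (auto simp: ordered_partition_on_iff)
  have e: "[] \<notin> Q" using Q by (auto simp: ordered_partition_on_iff)
  let ?S = "SIGMA xs:Q. {..length xs}"
  let ?g = "\<lambda>(xs, i). insert (insert_at x xs i) (Q - {xs})"
  \<comment> \<open>The new list contains \<open>x\<close> and no list of \<open>Q\<close> does. So
    it is the only element of the extended partition outside \<open>Q\<close> and can be read off
    from it.\<close>
  have nin: "insert_at x xs i \<notin> Q" for xs i using xQ[of "insert_at x xs i"] by auto
  have "inj_on ?g ?S"
  proof (rule inj_onI, clarify)
    fix xs i ys j
    assume h: "xs \<in> Q" "ys \<in> Q" "i \<le> length xs" "j \<le> length ys"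
      and "insert (insert_at x xs i) (Q - {xs}) = insert (insert_at x ys j) (Q - {ys})"
    then have "insert_at x xs i = insert_at x ys j"
      using nin by blast
    then show "xs = ys \<and> i = j"
      using insert_at_inject h xQ by metis
  qed
  then have "(\<Sum>P\<in>?g ` ?S. f (card P)) = (\<Sum>p\<in>?S. f (card (?g p)))"
    by (simp add: sum.reindex)
  also have "\<dots> = (\<Sum>p\<in>?S. f (card Q))"
  proof (rule sum.cong)
    fix p assume "p \<in> ?S"
    then obtain xs i where p: "p = (xs, i)" "xs \<in> Q" by auto
    have "card (?g p) = Suc (card (Q - {xs}))"
      using fin nin p(1) by simp
    then show "f (card (?g p)) = f (card Q)"
      using card_Suc_Diff1[OF fin p(2)] by simp
  qed simp
  also have "\<dots> = real (card ?S) * f (card Q)" by simp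
  also have "card ?S = card A + card Q"
    using fin sum_length_ordered_partition[OF assms(1,2)] by (simp add: sum_Suc)
  finally have *: "(\<Sum>P\<in>?g ` ?S. f (card P)) = real (card A + card Q) * f (card Q)" .
  have "insert [x] Q \<notin> ?g ` ?S"
  proof
    assume "insert [x] Q \<in> ?g ` ?S"
    then obtain xs i where h: "xs \<in> Q" "insert [x] Q = insert (insert_at x xs i) (Q - {xs})"
      by auto
    \<comment> \<open>\<open>xs\<close> lies in the left set, while on the right it was removed, so
      it can only be the inserted list.\<close>
    then have "xs = insert_at x xs i" by blast
    with h(1) nin show False by metis
  qed
  moreover have "finite (?g ` ?S)" using fin by auto
  moreover have "card (insert [x] Q) = Suc (card Q)" proof -
    have "[x] \<notin> Q" using xQ[of "[x]"] by auto
    then show ?thesis using fin by simp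
  qed
  ultimately show ?thesis unfolding extensions_def using * by (simp add: sum.insert)
qed

lemma sum_ordered_partitions_insert:
  fixes f :: "nat \<Rightarrow> real"
  assumes fin: "finite A" and x: "x \<notin> A" and D: "D \<subseteq> A"
  shows "(\<Sum>P\<in>ordered_partitions (insert x A) D. f (card P)) =
    (\<Sum>Q\<in>ordered_partitions A D. f (Suc (card Q)) + real (card A + card Q) * f (card Q))"
proof -
  let ?O = "ordered_partitions A D"
  have "extensions x Q \<inter> extensions x Q' = {}" if "Q \<in> ?O" "Q' \<in> ?O" "Q \<noteq> Q'" for Q Q'
  proof (rule equals0I)
    fix P assume P: "P \<in> extensions x Q \<inter> extensions x Q'"
    have "removeAll x ` P - {[]} = R" if "R \<in> ?O" "P \<in> extensions x R" for R
      using that x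
      by (intro extensions_remove) (auto simp: ordered_partitions_def ordered_partition_on_iff)
    then show False using P that by blast
  qed
  moreover have "finite (extensions x Q)" if "Q \<in> ?O" for Q
    using finite_subset[OF extensions_subset[OF that x D]] fin
    by (simp add: finite_ordered_partitions)
  ultimately have "(\<Sum>P\<in>(\<Union>Q\<in>?O. extensions x Q). f (card P)) =
      (\<Sum>Q\<in>?O. \<Sum>P\<in>extensions x Q. f (card P))"
    by (intro sum.UNION_disjoint) (auto simp: finite_ordered_partitions fin)
  also have "\<dots> = (\<Sum>Q\<in>?O. f (Suc (card Q)) + real (card A + card Q) * f (card Q))"
    by (intro sum.cong refl sum_extensions[OF fin _ x]) (simp add: ordered_partitions_def)
  finally show ?thesis by (simp add: ordered_partitions_insert[OF x D])
qed

text \<open>Each block has at least one element, and distinct elements of \<open>D\<close> lie in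
  distinct blocks. With \<open>card D = r\<close> the lower bound makes the natural number
  \<open>card P - r\<close> a true difference.\<close>

lemma card_ordered_partition_bounds:
  assumes "finite A" "D \<subseteq> A" and P: "P \<in> ordered_partitions A D"
  shows "card D \<le> card P" "card P \<le> card A"
proof -
  have op: "ordered_partition_on A P"
    using P by (simp add: ordered_partitions_def)
  have fin: "finite P" by (rule ordered_partition_on_finite[OF assms(1) op])
  have "card P = (\<Sum>xs\<in>P. 1)" by simp
  also have "\<dots> \<le> (\<Sum>xs\<in>P. length xs)"
    using ordered_partitionsD(2)[OF P] by (intro sum_mono) (simp add: Suc_le_eq)
  finally show "card P \<le> card A" by (simp add: sum_length_ordered_partition[OF assms(1) op])
  have "\<forall>a\<in>D. \<exists>xs\<in>P. a \<in> set xs"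
    using ordered_partitionsD(1)[OF P] assms(2) by blast
  then obtain b where b: "\<forall>a\<in>D. b a \<in> P \<and> a \<in> set (b a)" by metis
  have "inj_on b D"
    by (rule inj_onI) (use b ordered_partitionsD(4)[OF P] in metis)
  then show "card D \<le> card P"
    using b fin by (intro card_inj_on_le) auto
qed

section \<open>Rising and falling factorials\<close>

lemma pochhammer_eq_sum_ordered_partitions:
  fixes y :: real
  shows "pochhammer (y + 2 * real r) n =
    (\<Sum>P\<in>ordered_partitions {..<n + r} {..<r}. \<Prod>i<card P - r. y - real i)"
proof (induction n)
  case 0
  \<comment> \<open>The only partition has \<open>r\<close> blocks, so its product is empty,
    matching the rising factorial of order 0.\<close>
  have "card ((\<lambda>a. [a]) ` {..<r}) = r"
    by (subst card_image) (auto simp: inj_on_def)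
  then show ?case by (simp add: ordered_partitions_self)
next
  case (Suc n)
  let ?O = "ordered_partitions {..<n + r} {..<r}"
  let ?f = "\<lambda>k. \<Prod>i<k - r. y - real i"
  \<comment> \<open>The longer product has the extra factor y - (card Q - r). Adding the n + r +
    card Q positions to it gives y + 2r + n, in which \<open>card Q\<close> cancels.\<close>
  have step: "?f (Suc (card Q)) + real (card {..<n + r} + card Q) * ?f (card Q) =
      (y + 2 * real r + real n) * ?f (card Q)" if "Q \<in> ?O" for Q
  proof -
    have "r \<le> card Q" using card_ordered_partition_bounds(1)[OF _ _ that] by simp
    then show ?thesis by (simp add: Suc_diff_le algebra_simps)
  qed
  have "{..<Suc n + r} = insert (n + r) {..<n + r}" by (simp add: lessThan_Suc)
  then have "(\<Sum>P\<in>ordered_partitions {..<Suc n + r} {..<r}. ?f (card P)) =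
      (\<Sum>Q\<in>?O. ?f (Suc (card Q)) + real (card {..<n + r} + card Q) * ?f (card Q))"
    by (simp only: sum_ordered_partitions_insert[of "{..<n + r}" "n + r" "{..<r}" ?f]
        finite_lessThan lessThan_iff lessThan_subset_iff)
  also have "\<dots> = (\<Sum>Q\<in>?O. (y + 2 * real r + real n) * ?f (card Q))"
    by (intro sum.cong refl step)
  also have "\<dots> = pochhammer (y + 2 * real r) (Suc n)"
    unfolding pochhammer_Suc Suc.IH sum_distrib_left[symmetric] by (rule mult.commute)
  finally show ?case by (rule sym)
qed

section \<open>Falling factorials and the series for e\<close>

lemma prod_falling_times_fact: "(\<Prod>i<k. real (x + k) - real i) * fact x = fact (x + k)"
proof (induction k)
  case (Suc k)
  have "(\<Prod>i<Suc k. real (x + Suc k) - real i) = real (x + Suc k) * (\<Prod>i<k. real (x + k) - real i)"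
    \<comment> \<open>Split off the factor for i = 0; in the others, the shift of the index lowers
      the argument from x + k + 1 to x + k.\<close>
    by (subst prod.lessThan_Suc_shift) simp
  then have "(\<Prod>i<Suc k. real (x + Suc k) - real i) * fact x = real (x + Suc k) * fact (x + k)"
    by (simp only: mult.assoc Suc)
  then show ?case by simp
qed simp

text \<open>The first \<open>k\<close> terms vanish, since the factor with i = x is zero, and the
  later ones are the terms 1/x! of the series for e shifted by \<open>k\<close>. The value is
  therefore the same for every \<open>k\<close>.\<close>

lemma falling_over_fact_sums: "(\<lambda>x. (\<Prod>i<k. real x - real i) / fact x) sums exp 1"
proof -
  have "(\<Prod>i<k. real (x + k) - real i) / fact (x + k) = 1 / fact x" for x
    by (simp flip: prod_falling_times_fact)
  moreover have "(\<lambda>x. 1 / fact x) sums exp (1 :: real)"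
    using exp_converges[of "1 :: real"] by (simp add: field_simps)
  ultimately have "(\<lambda>x. (\<Prod>i<k. real (x + k) - real i) / fact (x + k)) sums exp 1"
    by (simp only:)
  moreover have "(\<Prod>i<k. real x - real i) / fact x = 0" if "x < k" for x
    using that by (auto intro: prod_zero)
  ultimately show ?thesis by (subst (asm) sums_zero_iff_shift) auto
qed

section \<open>Lah-Bell numbers as counts of ordered partitions\<close>

lemma Lah_Bell_eq_card: "Lah_Bell n r = card (ordered_partitions {..<n + r} {..<r})"
proof -
  let ?O = "ordered_partitions {..<n + r} {..<r}"
  have fin: "finite ?O" by (simp add: finite_ordered_partitions)
  have bounds: "r \<le> card P \<and> card P \<le> n + r" if "P \<in> ?O" for P
    using card_ordered_partition_bounds[OF _ _ that] by simp
  have "card ?O = (\<Sum>k\<in>{0..n}. card {P \<in> ?O. card P - r = k})"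
  proof -
    \<comment> \<open>Classify the partitions by the number of blocks beyond \<open>r\<close>; the
      bounds put it into \<open>{0..n}\<close>, so the classes exhaust \<open>?O\<close>.\<close>
    have "(\<lambda>P. card P - r) ` ?O \<subseteq> {0..n}" using bounds by fastforce
    from sum.group[OF fin _ this, of "\<lambda>_. 1 :: nat"] show ?thesis by simp
  qed
  also have "\<dots> = (\<Sum>k = 0..n. r_Lah r n k)"
  proof (intro sum.cong refl)
    fix k
    have "{P \<in> ?O. card P - r = k} =
        {P. ordered_partition_on {..<n + r} P \<and> card P = k + r \<and> separates P {..<r}}"
      using bounds by (fastforce simp: ordered_partitions_def)
    then show "card {P \<in> ?O. card P - r = k} = r_Lah r n k"
      by (simp add: r_Lah_def)
  qed
  finally show ?thesis by (simp add: Lah_Bell_def)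
qed

theorem theorem4:
  fixes n r :: nat
  shows "summable (\<lambda>k. pochhammer (real (k + 2 * r)) n / fact k) \<and>
    real (Lah_Bell n r) = 1 / exp 1 * (\<Sum>k. pochhammer (real (k + 2 * r)) n / fact k)"
proof -
  \<comment> \<open>Only finitely many \<open>P\<close> occur, so the series may be added termwise;
    every \<open>P\<close> contributes \<open>exp 1\<close>, and the total is their number times
    e.\<close>
  have "(\<lambda>k. \<Sum>P\<in>ordered_partitions {..<n + r} {..<r}. (\<Prod>i<card P - r. real k - real i) / fact k)
      sums (\<Sum>P\<in>ordered_partitions {..<n + r} {..<r}. exp 1)"
    by (intro sums_sum falling_over_fact_sums)
  moreover have "pochhammer (real (k + 2 * r)) n / fact k =
      (\<Sum>P\<in>ordered_partitions {..<n + r} {..<r}. (\<Prod>i<card P - r. real k - real i) / fact k)" for k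
    using pochhammer_eq_sum_ordered_partitions[of "real k" r n] by (simp add: sum_divide_distrib)
  ultimately have "(\<lambda>k. pochhammer (real (k + 2 * r)) n / fact k) sums (real (Lah_Bell n r) * exp 1)"
    by (simp add: Lah_Bell_eq_card)
  then show ?thesis by (auto simp: sums_iff)
qed

end
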